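(* Let $H$ be a real Hilbert space and let $f, g \in \Gamma_0(H)$ with $\mathrm{dom}(f) \cap \mathrm{dom}(g) \neq \emptyset$ and such that $\partial(f+g) = \partial f + \partial g$. If either $\partial f$ or $\partial g$ is single-valued, then $\mathrm{prox}^f_g$ is single-valued.
   Context: $\Gamma_0(H)$ is the set of proper, lower semicontinuous, convex functions $H \to \mathbb{R} \cup \{+\infty\}$. For $g : H \to \mathbb{R}\cup\{+\infty\}$, $\mathrm{dom}(g) = \{x \in H : g(x) < +\infty\}$. For $g \in \Gamma_0(H)$, the subdifferential is the set-valued map $\partial g(x) = \{ y \in H : \langle y, z-x\rangle \le g(z)-g(x)\ \forall z \in H\}$. Sums of set-valued maps are pointwise Minkowski sums (empty if one of the summands is empty). For a set-valued map $A : H \rightrightarrows H$, $\mathrm{D}(A) = \{x \in H : A(x) \neq \emptyset\}$ and $A^{-1}(y) = \{x \in H : y \in A(x)\}$; $A$ is called single-valued if $A(x)$ is a singleton for all $x \in \mathrm{D}(A)$. $I$ is the identity operator. The proximal operator of $f \in \Gamma_0(H)$ is $\mathrm{prox}_f = (I+\partial f)^{-1}$, which is single-valued and defined everywhere on $H$. The $f$-proximal operator of $g$ is the set-valued map $\mathrm{prox}^f_g : H \rightrightarrows H$ defined by $\mathrm{prox}^f_g = (I + \partial g \circ \mathrm{prox}_f)^{-1}$; that is, $y \in \mathrm{prox}^f_g(x)$ if and only if $x - y \in \partial g(\mathrm{prox}_f(y))$. *)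

theory Defs
  imports "HOL-Analysis.Analysis" "HOL-Library.Set_Algebras"
begin

section \<open>Set-valued maps\<close>

text \<open>A set-valued map from \<open>'a\<close> to \<open>'b\<close> is a function of type \<open>'a \<Rightarrow> 'b set\<close>; \<open>+\<close> on sets is
  the Minkowski sum.\<close>

definition setmap_dom :: "('a \<Rightarrow> 'b set) \<Rightarrow> 'a set" where
  "setmap_dom A = {x. A x \<noteq> {}}"

definition setmap_inv :: "('a \<Rightarrow> 'b set) \<Rightarrow> 'b \<Rightarrow> 'a set" where
  "setmap_inv A y = {x. y \<in> A x}"

definition setmap_add :: "('a \<Rightarrow> 'b::plus set) \<Rightarrow> ('a \<Rightarrow> 'b set) \<Rightarrow> 'a \<Rightarrow> 'b set" where
  "setmap_add A B x = A x + B x"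

definition setmap_comp :: "('b \<Rightarrow> 'c set) \<Rightarrow> ('a \<Rightarrow> 'b set) \<Rightarrow> 'a \<Rightarrow> 'c set" where
  "setmap_comp A B x = (\<Union>u\<in>B x. A u)"

definition setmap_id :: "'a \<Rightarrow> 'a set" where
  "setmap_id x = {x}"

definition setmap_single_valued :: "('a \<Rightarrow> 'b set) \<Rightarrow> bool" where
  "setmap_single_valued A \<longleftrightarrow> (\<forall>x\<in>setmap_dom A. is_singleton (A x))"

section \<open>Convex functions with values in the reals and \<open>+\<infinity>\<close>\<close>

definition eff_dom :: "('a \<Rightarrow> ereal) \<Rightarrow> 'a set" where
  "eff_dom g = {x. g x < \<infinity>}"

definition proper :: "('a \<Rightarrow> ereal) \<Rightarrow> bool" where
  "proper g \<longleftrightarrow> (\<forall>x. g x \<noteq> -\<infinity>) \<and> eff_dom g \<noteq> {}"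

text \<open>The filter \<open>at x\<close> is punctured, which does not affect the notion: including the point
  \<open>x\<close> itself could only replace the limit inferior by its minimum with \<open>g x\<close>.\<close>

definition lower_semicontinuous :: "('a::topological_space \<Rightarrow> ereal) \<Rightarrow> bool" where
  "lower_semicontinuous g \<longleftrightarrow> (\<forall>x. g x \<le> Liminf (at x) g)"

definition ereal_convex :: "('a::real_vector \<Rightarrow> ereal) \<Rightarrow> bool" where
  "ereal_convex g \<longleftrightarrow> (\<forall>x y t. 0 < t \<longrightarrow> t < 1 \<longrightarrow>
     g ((1 - t) *\<^sub>R x + t *\<^sub>R y) \<le> ereal (1 - t) * g x + ereal t * g y)"

definition Gamma0 :: "('a::real_inner \<Rightarrow> ereal) set" where
  "Gamma0 = {g. proper g \<and> lower_semicontinuous g \<and> ereal_convex g}"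

section \<open>Subdifferential and proximal operators\<close>

text \<open>Where \<open>g x = \<infinity>\<close>, the difference \<open>g z - g x\<close> is \<open>-\<infinity>\<close> for every \<open>z\<close> in the effective
  domain, so for proper \<open>g\<close> the subdifferential is empty there. The convention
  \<open>\<infinity> - \<infinity> = \<infinity>\<close> of \<^typ>\<open>ereal\<close> therefore has no influence.\<close>

definition subdifferential :: "('a::real_inner \<Rightarrow> ereal) \<Rightarrow> 'a \<Rightarrow> 'a set" where
  "subdifferential g x = {y. \<forall>z. ereal (inner y (z - x)) \<le> g z - g x}"

definition prox :: "('a::real_inner \<Rightarrow> ereal) \<Rightarrow> 'a \<Rightarrow> 'a set" where
  "prox f = setmap_inv (setmap_add setmap_id (subdifferential f))"

text \<open>\<open>prox_rel f g\<close> is the \<open>f\<close>-proximal operator of \<open>g\<close>.\<close>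

definition prox_rel :: "('a::real_inner \<Rightarrow> ereal) \<Rightarrow> ('a \<Rightarrow> ereal) \<Rightarrow> 'a \<Rightarrow> 'a set" where
  "prox_rel f g =
     setmap_inv (setmap_add setmap_id (setmap_comp (subdifferential g) (prox f)))"

lemma mem_prox_rel_iff:
  assumes "prox f y = {p}"
  shows "y \<in> prox_rel f g x \<longleftrightarrow> x - y \<in> subdifferential g p"
proof -
  have "y \<in> prox_rel f g x \<longleftrightarrow> (\<exists>b\<in>subdifferential g p. x = y + b)"
    using assms by (simp add: prox_rel_def setmap_inv_def setmap_add_def setmap_comp_def
      setmap_id_def set_plus_def)
  also have "\<dots> \<longleftrightarrow> x - y \<in> subdifferential g p"
    by (metis add_diff_cancel_left' add.commute diff_add_cancel)
  finally show ?thesis .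
qed

end

theory Submission
  imports Defs
begin

text \<open>Unfolded, \<open>y \<in> prox_rel f g x\<close> splits \<open>x = p + u + v\<close> with \<open>u \<in> subdifferential f p\<close> and
  \<open>v \<in> subdifferential g p\<close>, where \<open>y = p + u\<close>. Subdifferentials of proper functions are monotone,
  so adding the identity to their sum gives a strongly monotone map, which can take the value \<open>x\<close>
  at only one point \<open>p\<close> (\<open>monotone_resolvent_point_unique\<close>). Two elements \<open>y\<close> of the same
  \<open>prox_rel f g x\<close> thus share the point \<open>p\<close> and can differ only through the choice of the pair
  \<open>(u, v)\<close>. As \<open>u + v = x - p\<close> is fixed, either of \<open>u\<close> and \<open>v\<close> determines the other, and
  single-valuedness of one subdifferential leaves no choice.\<close>

lemma subdifferential_finite:
  assumes "proper g" "u \<in> subdifferential g x"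
  shows "\<bar>g x\<bar> \<noteq> \<infinity>"
proof -
  from \<open>proper g\<close> obtain z where z: "g z < \<infinity>" and bot: "g z \<noteq> -\<infinity>" "g x \<noteq> -\<infinity>"
    unfolding proper_def eff_dom_def by auto
  have "ereal (inner u (z - x)) \<le> g z - g x"
    using assms(2) unfolding subdifferential_def by blast
  with z bot show ?thesis
    by (cases "g x"; cases "g z") auto
qed

text \<open>Adding the two subgradient inequalities, each evaluated at the other point, cancels the
  function values; these are finite because \<open>g\<close> is proper.\<close>

lemma subdifferential_monotone:
  assumes "proper g" "u \<in> subdifferential g x" "v \<in> subdifferential g y"
  shows "0 \<le> inner (u - v) (x - y)"
proof -
  obtain a b where ab: "g x = ereal a" "g y = ereal b"
    using subdifferential_finite[OF assms(1,2)] subdifferential_finite[OF assms(1,3)]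
    by (cases "g x"; cases "g y") auto
  have "ereal (inner u (y - x)) \<le> g y - g x" "ereal (inner v (x - y)) \<le> g x - g y"
    using assms(2,3) unfolding subdifferential_def by blast+
  then show ?thesis
    using ab by (simp add: inner_diff_left inner_diff_right)
qed

lemma mem_prox_rel_imp:
  assumes "y \<in> prox_rel f g x"
  obtains p where "y - p \<in> subdifferential f p" "x - y \<in> subdifferential g p"
proof -
  from assms obtain p u v where "u \<in> subdifferential f p" "y = p + u"
    and "v \<in> subdifferential g p" "x = y + v"
    unfolding prox_rel_def prox_def setmap_inv_def setmap_add_def setmap_comp_def
      setmap_id_def set_plus_def by auto
  then show thesis
    by (intro that[of p]) auto
qed

text \<open>If \<open>p + u + v = q + u' + v'\<close>, the pairing of \<open>(u - u') + (v - v') = q - p\<close> with \<open>p - q\<close> is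
  minus the squared distance of \<open>p\<close> and \<open>q\<close>, and monotonicity makes it nonnegative.\<close>

lemma monotone_resolvent_point_unique:
  fixes p q :: "'a::real_inner"
  assumes "0 \<le> inner (u - u') (p - q)" "0 \<le> inner (v - v') (p - q)"
    and "p + u + v = q + u' + v'"
  shows "p = q"
proof -
  have "(u - u') + (v - v') = - (p - q)"
    using assms(3) by (simp add: algebra_simps)
  then have "inner (u - u') (p - q) + inner (v - v') (p - q) = - inner (p - q) (p - q)"
    by (metis inner_add_left inner_minus_left)
  with assms(1,2) have "inner (p - q) (p - q) \<le> 0"
    by linarith
  then show ?thesis
    by (metis eq_iff_diff_eq_0 inner_gt_zero_iff not_less)
qed

lemma setmap_single_valued_iff:
  "setmap_single_valued A \<longleftrightarrow> (\<forall>x. \<forall>u\<in>A x. \<forall>v\<in>A x. u = v)"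
  unfolding setmap_single_valued_def setmap_dom_def
  by (auto intro: is_singletonI' elim!: is_singletonE)

theorem proposition2p18:
  fixes f g :: "'h::{real_inner, complete_space} \<Rightarrow> ereal"
  assumes "f \<in> Gamma0" and "g \<in> Gamma0"
    and "eff_dom f \<inter> eff_dom g \<noteq> {}"
    and "subdifferential (\<lambda>x. f x + g x) = setmap_add (subdifferential f) (subdifferential g)"
    and "setmap_single_valued (subdifferential f) \<or> setmap_single_valued (subdifferential g)"
  shows "setmap_single_valued (prox_rel f g)"
  unfolding setmap_single_valued_iff
proof (intro allI ballI)
  fix x y z
  assume "y \<in> prox_rel f g x" "z \<in> prox_rel f g x"
  then obtain p q
    where y: "y - p \<in> subdifferential f p" "x - y \<in> subdifferential g p"
      and z: "z - q \<in> subdifferential f q" "x - z \<in> subdifferential g q"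
    by (metis mem_prox_rel_imp)
  have "proper f" "proper g"
    using assms(1,2) unfolding Gamma0_def by auto
  then have "p = q"
    by (intro monotone_resolvent_point_unique[OF subdifferential_monotone[OF _ y(1) z(1)]
          subdifferential_monotone[OF _ y(2) z(2)]]) auto
  from assms(5) show "y = z"
  proof
    assume "setmap_single_valued (subdifferential f)"
    then have "y - p = z - p"
      using y z \<open>p = q\<close> unfolding setmap_single_valued_iff by blast
    then show ?thesis by simp
  next
    assume "setmap_single_valued (subdifferential g)"
    then have "x - y = x - z"
      using y z \<open>p = q\<close> unfolding setmap_single_valued_iff by blast
    then show ?thesis by simp
  qed
qed

end
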